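(* Let $n\ge2$ be an integer and $\beta\in(0,1)$. Then the Clopper-Pearson upray $K_{\mathrm{CP},n}=K_{\mathrm{CP},n,\beta}$ is not a $\beta$-confidence region for the average success probability, i.e. there is $p\in[0,1]^n$ with $\mathrm{BC}_p(\{x : \overline p\in K_{\mathrm{CP},n}(x)\})<\beta$. If moreover $\beta\ge\beta_n$, then the effective level of $K_{\mathrm{CP},n}$ is $$\inf_{p\in[0,1]^n}\mathrm{BC}_p\big(\{x : \overline p\in K_{\mathrm{CP},n}(x)\}\big)=\gamma_n:=1-n\left(1-\beta^{1/n}\right),\qquad \gamma_n\in\left(1+\log\beta,\ \beta\right).$$ Furthermore, for fixed $\beta\in(0,1)$, $\gamma_n$ decreases to $1+\log\beta<\beta$ as $n\to\infty$, and consequently, if $\beta>\frac{2}{\mathrm e}$, the $K_{\mathrm{CP},n}$ are not even asymptotic $\beta$-confidence regions, i.e. $\liminf_{n\to\infty}\inf_{p\in[0,1]^n}\mathrm{BC}_p(\{x : \overline p\in K_{\mathrm{CP},n}(x)\})<\beta$.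
   Context: $\mathrm{B}_{n,p}$ is the binomial law with parameters $n$ and $p\in[0,1]$. For $p=(p_1,\ldots,p_n)\in[0,1]^n$, $\mathrm{BC}_p$ is the Bernoulli convolution (Poisson-binomial law), i.e. the law of the sum of $n$ independent Bernoulli variables with success probabilities $p_1,\ldots,p_n$, and $\overline p:=\frac1n\sum_{j=1}^n p_j$. For $x\in\{1,\ldots,n\}$, $g_n(x)=g_{n,\beta}(x)$ denotes the unique $p\in[0,1]$ with $\mathrm{B}_{n,p}(\{x,\ldots,n\})=1-\beta$. The Clopper-Pearson upray $K_{\mathrm{CP},n}\colon\{0,\ldots,n\}\to2^{[0,1]}$ is $K_{\mathrm{CP},n}(0):=[0,1]$ and $K_{\mathrm{CP},n}(x):=(g_n(x),1]$ for $x\in\{1,\ldots,n\}$. Put $\beta_n:=\mathrm{B}_{n,1/n}(\{0,1\})$. A $\beta$-confidence region for the average success probability is a function $K\colon\{0,\ldots,n\}\to2^{[0,1]}$ with $\mathrm{BC}_p(\{x : \overline p\in K(x)\})\ge\beta$ for all $p\in[0,1]^n$. *)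

theory Defs
  imports "HOL-Probability.Probability"
begin

definition unit_cube :: "nat \<Rightarrow> (nat \<Rightarrow> real) set" where
  "unit_cube n = {1..n} \<rightarrow>\<^sub>E {0..1}"

definition avg :: "nat \<Rightarrow> (nat \<Rightarrow> real) \<Rightarrow> real" where
  "avg n p = (\<Sum>j=1..n. p j) / real n"

text \<open>The Bernoulli convolution (Poisson-binomial law): the law of the sum of
  independent Bernoulli variables with success probabilities \<open>p 1, \<dots>, p n\<close>.\<close>

definition bernoulli_convolution :: "nat \<Rightarrow> (nat \<Rightarrow> real) \<Rightarrow> nat pmf" where
  "bernoulli_convolution n p =
     map_pmf (\<lambda>\<omega>. \<Sum>j=1..n. of_bool (\<omega> j)) (Pi_pmf {1..n} False (\<lambda>j. bernoulli_pmf (p j)))"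

text \<open>Regions \<open>K\<close> are total functions on \<open>nat\<close>; only their values on \<open>{0..n}\<close> are used.\<close>

definition coverage :: "nat \<Rightarrow> (nat \<Rightarrow> real set) \<Rightarrow> (nat \<Rightarrow> real) \<Rightarrow> real" where
  "coverage n K p =
     measure_pmf.prob (bernoulli_convolution n p) {x \<in> {0..n}. avg n p \<in> K x}"

definition confidence_region_avg :: "nat \<Rightarrow> real \<Rightarrow> (nat \<Rightarrow> real set) \<Rightarrow> bool" where
  "confidence_region_avg n \<beta> K \<longleftrightarrow> (\<forall>p \<in> unit_cube n. coverage n K p \<ge> \<beta>)"

definition effective_level :: "nat \<Rightarrow> (nat \<Rightarrow> real set) \<Rightarrow> real" where
  "effective_level n K = (INF p \<in> unit_cube n. coverage n K p)"

text \<open>The description is proper for \<open>0 < \<beta> < 1\<close> and \<open>1 \<le> x \<le> n\<close>, where the binomial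
  tail probability is continuous and strictly increasing in \<open>p\<close>, from 0 to 1.\<close>

definition cp_bound :: "nat \<Rightarrow> real \<Rightarrow> nat \<Rightarrow> real" where
  "cp_bound n \<beta> x =
     (THE p. p \<in> {0..1} \<and> measure_pmf.prob (binomial_pmf n p) {x..n} = 1 - \<beta>)"

definition clopper_pearson :: "nat \<Rightarrow> real \<Rightarrow> nat \<Rightarrow> real set" where
  "clopper_pearson n \<beta> x = (if x = 0 then {0..1} else {cp_bound n \<beta> x<..1})"

definition beta_crit :: "nat \<Rightarrow> real" where
  "beta_crit n = measure_pmf.prob (binomial_pmf n (1 / real n)) {0, 1}"

definition gamma_level :: "real \<Rightarrow> nat \<Rightarrow> real" where
  "gamma_level \<beta> n = 1 - real n * (1 - \<beta> powr (1 / real n))"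

end

theory Submission
  imports Defs "HOL-Real_Asymp.Real_Asymp"
begin

text \<open>
  Let \<open>g\<close> be the lower confidence bound for one observed success, so that \<open>(1 - g)\<^sup>n = \<beta>\<close>. If the
  average success probability equals \<open>g\<close>, it is covered only when no success occurs, which has
  probability \<open>\<Prod>j. (1 - p\<^sub>j)\<close> (\<open>coverage_at_first_bound\<close>). This product equals \<open>\<beta>\<close> for equal
  parameters and is smaller for any others, whence the upray is not a confidence region; it is
  smallest, equal to \<open>1 - n g = \<gamma>\<^sub>n\<close>, when the whole mean is concentrated in one coordinate
  (possible if \<open>n g \<le> 1\<close>).

  That nothing worse happens for \<open>\<beta> \<ge> \<beta>\<^sub>n\<close> rests on an inequality of Hoeffding
  (\<open>hoeffding_binomial_minimal\<close>): if \<open>S\<close> is a sum of independent Bernoulli variables with mean at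
  most \<open>m\<close>, then \<open>P (S \<le> m)\<close> is at least the value for the binomial law with the same mean. If the
  average lies between the bounds for \<open>m\<close> and \<open>m + 1\<close> successes, the coverage is \<open>P (S \<le> m)\<close>, and
  the binomial value is at least \<open>\<beta>\<close> by the choice of the bounds. So for \<open>m \<ge> 1\<close> it suffices that
  the bound for \<open>m + 1\<close> is at most \<open>m / n\<close>, i.e. that the binomial law with mean \<open>m\<close> satisfies
  \<open>P (S \<le> m) \<le> \<beta>\<close>. This holds since that probability is at most its value \<open>\<beta>\<^sub>n\<close> for \<open>m = 1\<close>
  (\<open>binomial_cdf_at_integer_mean\<close>). For \<open>2 \<le> m \<le> n - 2\<close> Hoeffding's inequality itself proves this,
  by comparison with four fair coins and otherwise deterministic summands. For \<open>m = 0\<close> the bound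
  \<open>\<Prod>j. (1 - p\<^sub>j) \<ge> 1 - \<Sum>j. p\<^sub>j\<close> yields \<open>\<gamma>\<^sub>n\<close>.

  Distributions are handled through their generating polynomials \<open>\<Prod>j. (1 - p\<^sub>j + p\<^sub>j x)\<close>. In
  Hoeffding's inequality a change of two parameters with fixed sum alters the polynomial by a multiple
  of \<open>(1 - x)\<^sup>2\<close>, so that its effect on \<open>P (S \<le> m)\<close> is governed by a difference of two neighbouring
  probabilities of the remaining summands. A compactness argument then identifies the minimiser.
\<close>

section \<open>Lower tails of generating polynomials\<close>

definition gen_poly :: "'a set \<Rightarrow> ('a \<Rightarrow> real) \<Rightarrow> real poly" where
  "gen_poly A p = (\<Prod>j\<in>A. [:1 - p j, p j:])"

definition lower_tail :: "real poly \<Rightarrow> nat \<Rightarrow> real" where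
  "lower_tail Q m = (\<Sum>k\<le>m. coeff Q k)"

lemma lower_tail_diff: "lower_tail (P - Q) m = lower_tail P m - lower_tail Q m"
  by (simp add: lower_tail_def sum_subtractf)

lemma lower_tail_smult: "lower_tail (smult c P) m = c * lower_tail P m"
  by (simp add: lower_tail_def sum_distrib_left)

lemma coeff_linear_mult:
  "coeff ([:a, b:] * P) k = a * coeff P k + (if k = 0 then 0 else b * coeff P (k - 1))"
  for a b :: real
  by (cases k) (simp_all add: coeff_pCons)

text \<open>Partial sums of coefficients are division by \<open>1 - x\<close>, hence a factor \<open>1 - x\<close> turns a
  tail into a single coefficient. This is what makes the effect of moving success probabilities
  computable.\<close>

lemma lower_tail_difference_mult: "lower_tail ([:1, -1:] * P) m = coeff P m"
  by (induction m) (simp_all add: lower_tail_def coeff_pCons)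

lemma coeff_one_minus_power:
  "coeff ([:1 - q, q:] ^ n) k = real (n choose k) * q ^ k * (1 - q) ^ (n - k)"
proof (cases "k \<le> n")
  case True
  then show ?thesis by (simp add: coeff_linear_poly_power)
next
  case False
  have "degree ([:1 - q, q:] ^ n) \<le> n"
    using degree_power_le[of "[:1 - q, q:]" n] degree_pCons_le[of "1 - q" "[:q:]"]
    by (cases "q = 0") auto
  then show ?thesis using False by (simp add: coeff_eq_0 binomial_eq_0)
qed

lemma continuous_coeff_gen_poly:
  assumes "finite A"
  shows "continuous_on UNIV (\<lambda>p. coeff (gen_poly A p) k)"
  using assms
proof (induction A arbitrary: k rule: finite_induct)
  case empty
  then show ?case by (simp add: gen_poly_def)
next
  case (insert x A)
  have "coeff (gen_poly (insert x A) p) k = (1 - p x) * coeff (gen_poly A p) k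
      + (if k = 0 then 0 else p x * coeff (gen_poly A p) (k - 1))" for p
    using insert.hyps by (simp add: gen_poly_def coeff_linear_mult del: mult_pCons_left)
  then show ?case
    using insert.IH by (cases "k = 0") (simp_all add: continuous_intros)
qed

lemma continuous_cum_gen_poly:
  assumes "finite A"
  shows "continuous_on UNIV (\<lambda>p. lower_tail (gen_poly A p) m)"
  unfolding lower_tail_def by (intro continuous_on_sum continuous_coeff_gen_poly assms)

lemma gen_poly_remove2:
  assumes "finite A" "i \<in> A" "j \<in> A" "i \<noteq> j"
  shows "gen_poly A p = [:1 - p i, p i:] * ([:1 - p j, p j:] * gen_poly (A - {i,j}) p)"
proof -
  have A: "A = insert i (insert j (A - {i,j}))" using assms by auto
  show ?thesis
    by (subst A) (use assms in \<open>simp add: gen_poly_def del: mult_pCons_left mult_pCons_right\<close>)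
qed

lemma gen_poly_cong: "(\<And>j. j \<in> A \<Longrightarrow> p j = q j) \<Longrightarrow> gen_poly A p = gen_poly A q"
  by (simp add: gen_poly_def)

text \<open>The product of two Bernoulli factors depends on \<open>a * b\<close> only through a multiple of
  \<open>(1 - x)\<^sup>2\<close> once \<open>a + b\<close> is held fixed.\<close>

lemma linear_factor_pair:
  "[:1 - a, a:] * [:1 - b, b:] = [:1 - (a + b), a + b:] + smult (a * b) ([:1, -1:] * [:1, -1:])"
  for a b :: real
  by (simp add: algebra_simps)

text \<open>Since the tail of \<open>(1 - x)\<^sup>2 P\<close> at \<open>m\<close> is the increment of the coefficients of \<open>P\<close> there,
  the sign of that increment decides whether bringing two parameters together, with their sum
  unchanged, increases or decreases the probability of at most \<open>m\<close> successes.\<close>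

lemma lower_tail_pair_change:
  assumes A: "finite A" "i \<in> A" "j \<in> A" "i \<noteq> j"
    and sum: "a + b = p i + p j" and m: "m \<ge> 1"
  shows "lower_tail (gen_poly A (p(i := a, j := b))) m = lower_tail (gen_poly A p) m
     + (a * b - p i * p j) * (coeff (gen_poly (A - {i,j}) p) m - coeff (gen_poly (A - {i,j}) p) (m - 1))"
proof -
  let ?P = "gen_poly (A - {i,j}) p" and ?q = "p(i := a, j := b)"
  have P: "gen_poly (A - {i,j}) ?q = ?P" by (rule gen_poly_cong) auto
  have "gen_poly A ?q - gen_poly A p
      = ([:1 - a, a:] * [:1 - b, b:] - [:1 - p i, p i:] * [:1 - p j, p j:]) * ?P"
    using A by (simp only: gen_poly_remove2[OF A, of ?q] gen_poly_remove2[OF A, of p] P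
          left_diff_distrib mult.assoc) simp
  also have "\<dots> = smult (a * b - p i * p j) ([:1, -1:] * ([:1, -1:] * ?P))"
    unfolding linear_factor_pair sum
    by (simp add: smult_diff_left left_diff_distrib mult.assoc del: mult_pCons_left mult_pCons_right)
  finally have "lower_tail (gen_poly A ?q) m - lower_tail (gen_poly A p) m
      = (a * b - p i * p j) * coeff ([:1, -1:] * ?P) m"
    by (metis lower_tail_diff lower_tail_smult lower_tail_difference_mult)
  then show ?thesis using m by (simp add: coeff_linear_mult del: mult_pCons_left)
qed

section \<open>Hoeffding's comparison with the binomial law\<close>

text \<open>The second criterion \<open>g\<close> breaks ties: a minimiser of the probability alone need not be the
  constant vector when the mean is exactly \<open>m\<close>.\<close>

lemma lexicographic_minimiser:
  fixes f g :: "'a::topological_space \<Rightarrow> real"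
  assumes "compact C" "C \<noteq> {}" "continuous_on C f" "continuous_on C g"
  obtains x where "x \<in> C" "\<And>y. y \<in> C \<Longrightarrow> f x \<le> f y" "\<And>y. y \<in> C \<Longrightarrow> f y \<le> f x \<Longrightarrow> g x \<le> g y"
proof -
  obtain x0 where x0: "x0 \<in> C" "\<forall>y\<in>C. f x0 \<le> f y"
    using continuous_attains_inf[OF assms(1-3)] by blast
  define M where "M = {y \<in> C. f y = f x0}"
  have "closedin (top_of_set C) M"
    unfolding M_def by (rule continuous_closedin_preimage_constant[OF assms(3)])
  then have "compact M" using assms(1) closedin_compact by blast
  moreover have "M \<noteq> {}" using x0 by (auto simp: M_def)
  moreover have "continuous_on M g" using assms(4) by (rule continuous_on_subset) (auto simp: M_def)
  ultimately obtain x where x: "x \<in> M" "\<forall>y\<in>M. g x \<le> g y"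
    using continuous_attains_inf by blast
  show thesis
  proof (rule that[of x])
    show "x \<in> C" using x by (simp add: M_def)
    show "f x \<le> f y" if "y \<in> C" for y using that x x0 by (simp add: M_def)
    show "g x \<le> g y" if "y \<in> C" "f y \<le> f x" for y
      using that x x0 by (simp add: M_def order_antisym)
  qed
qed

text \<open>The ratio of the two probabilities is \<open>(M - k + 1) a / (k (1 - a))\<close>, which is at most 1 exactly
  when \<open>(M + 1) a \<le> k\<close>.\<close>

lemma binomial_coeff_past_mode:
  assumes a: "0 \<le> a" "a \<le> 1" and k: "(real M + 1) * a \<le> real k" "k \<ge> 1"
  shows "coeff ([:1 - a, a:] ^ M) k \<le> coeff ([:1 - a, a:] ^ M) (k - 1)"
proof (cases "k \<le> M")
  case False
  then have "coeff ([:1 - a, a:] ^ M) k = 0"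
    by (simp add: coeff_one_minus_power binomial_eq_0)
  moreover have "0 \<le> coeff ([:1 - a, a:] ^ M) (k - 1)"
    using a by (simp add: coeff_one_minus_power)
  ultimately show ?thesis by simp
next
  case True
  obtain l where l: "k = Suc l" using k(2) by (cases k) auto
  define r where "r = M - k"
  have M: "M = r + Suc l" using True l by (simp add: r_def)
  have rec: "real (Suc l) * real (M choose Suc l) = (real M - real l) * real (M choose l)"
  proof -
    have "Suc l * (M choose Suc l) = (M - l) * (M choose l)"
      by (metis binomial_absorb_comp binomial_absorption M add_Suc_right diff_Suc_1)
    then have "real (Suc l * (M choose Suc l)) = real ((M - l) * (M choose l))" by simp
    then show ?thesis using M by (simp add: of_nat_diff algebra_simps)
  qed
  have "real (Suc l) * (real (M choose Suc l) * a) \<le> real (Suc l) * (real (M choose l) * (1 - a))"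
  proof -
    have "real (Suc l) * (real (M choose Suc l) * a) = (real M - real l) * a * real (M choose l)"
      using rec by (metis mult.assoc mult.commute)
    also have "\<dots> \<le> real (Suc l) * (1 - a) * real (M choose l)"
      by (rule mult_right_mono) (use k l in \<open>auto simp: algebra_simps\<close>)
    finally show ?thesis by (simp add: mult_ac)
  qed
  then have "real (M choose Suc l) * a \<le> real (M choose l) * (1 - a)"
    by (rule mult_left_le_imp_le) simp
  then have "real (M choose Suc l) * a * (a ^ l * (1 - a) ^ r)
      \<le> real (M choose l) * (1 - a) * (a ^ l * (1 - a) ^ r)"
    using a by (intro mult_right_mono) auto
  moreover have "M - Suc l = r" "M - l = Suc r" using M by auto
  ultimately show ?thesis
    unfolding coeff_one_minus_power l by (simp add: mult_ac)
qed

lemma sum_pair_update: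
  fixes h :: "real \<Rightarrow> real"
  assumes A: "finite A" "i \<in> A" "j \<in> A" "i \<noteq> j"
  shows "(\<Sum>x\<in>A. h ((q(i := a, j := b)) x)) = (\<Sum>x\<in>A - {i,j}. h (q x)) + (h a + h b)"
proof -
  have A': "A = insert i (insert j (A - {i,j}))" using A by auto
  show ?thesis by (subst A') (use A in \<open>auto intro!: sum.cong\<close>)
qed

definition cube_slice :: "'a set \<Rightarrow> real \<Rightarrow> ('a \<Rightarrow> real) set" where
  "cube_slice A \<mu> = {q. (\<forall>j\<in>A. q j \<in> {0..1}) \<and> (\<forall>j. j \<notin> A \<longrightarrow> q j = 0) \<and> sum q A = \<mu>}"

lemma compact_cube_slice: "compact (cube_slice A \<mu>)"
proof -
  let ?S = "\<lambda>j. if j \<in> A then {0..1::real} else {0}"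
  have "compactin (product_topology (\<lambda>i. euclidean) UNIV) (PiE UNIV ?S)"
    by (subst compactin_PiE) auto
  then have "compact (PiE UNIV ?S)" by (simp add: euclidean_product_topology)
  moreover have "closed {q. sum q A = \<mu>}"
    by (intro closed_Collect_eq continuous_intros continuous_on_sum) auto
  ultimately have "compact (PiE UNIV ?S \<inter> {q. sum q A = \<mu>})" by blast
  also have "PiE UNIV ?S \<inter> {q. sum q A = \<mu>} = cube_slice A \<mu>"
    unfolding cube_slice_def by (auto simp: PiE_iff if_split_mem2)
  finally show ?thesis .
qed

lemma cube_slice_pair_update:
  assumes "finite A" "i \<in> A" "j \<in> A" "i \<noteq> j" "q \<in> cube_slice A \<mu>"
    and "a \<in> {0..1}" "b \<in> {0..1}" "a + b = q i + q j"
  shows "q(i := a, j := b) \<in> cube_slice A \<mu>"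
proof -
  have "sum (q(i := a, j := b)) A = sum q (A - {i,j}) + (q i + q j)"
    using sum_pair_update[OF assms(1-4), of "\<lambda>x. x" q a b] assms(8) by simp
  also have "\<dots> = sum (q(i := q i, j := q j)) A"
    using sum_pair_update[OF assms(1-4), of "\<lambda>x. x" q "q i" "q j"] by simp
  also have "\<dots> = \<mu>" using assms(5) by (simp add: cube_slice_def)
  finally show ?thesis using assms by (auto simp: cube_slice_def)
qed

text \<open>By \<open>lower_tail_pair_change\<close>, if the increment at \<open>m\<close> were not positive, averaging the two
  parameters would not increase the tail but would decrease the sum of squares. As it is positive,
  the two parameters cannot be pushed further apart, since that would decrease the tail; so one of
  them has reached an end point.\<close>

lemma minimiser_pair:
  assumes A: "finite A" "i \<in> A" "j \<in> A" and q: "q \<in> cube_slice A \<mu>" and m: "m \<ge> 1"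
    and min: "\<And>r. r \<in> cube_slice A \<mu> \<Longrightarrow> lower_tail (gen_poly A q) m \<le> lower_tail (gen_poly A r) m"
    and lex: "\<And>r. r \<in> cube_slice A \<mu> \<Longrightarrow> lower_tail (gen_poly A r) m \<le> lower_tail (gen_poly A q) m
                \<Longrightarrow> (\<Sum>x\<in>A. (q x)\<^sup>2) \<le> (\<Sum>x\<in>A. (r x)\<^sup>2)"
    and lt: "q i < q j"
  shows "coeff (gen_poly (A - {i,j}) q) m > coeff (gen_poly (A - {i,j}) q) (m - 1)"
    and "q i = 0 \<or> q j = 1"
proof -
  let ?D = "coeff (gen_poly (A - {i,j}) q) m - coeff (gen_poly (A - {i,j}) q) (m - 1)"
  have ij: "i \<noteq> j" using lt by auto
  note A' = A ij
  have qi: "q i \<in> {0..1}" and qj: "q j \<in> {0..1}" using q A unfolding cube_slice_def by force+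
  have D: "?D > 0"
  proof (rule ccontr)
    assume neg: "\<not> ?D > 0"
    define s where "s = (q i + q j) / 2"
    let ?r = "q(i := s, j := s)"
    have r: "?r \<in> cube_slice A \<mu>"
      by (rule cube_slice_pair_update) (use A' q qi qj in \<open>auto simp: s_def\<close>)
    have prod: "s * s - q i * q j = ((q j - q i) / 2)\<^sup>2"
      by (simp add: s_def power2_eq_square field_simps)
    have "lower_tail (gen_poly A ?r) m = lower_tail (gen_poly A q) m + (s * s - q i * q j) * ?D"
      by (rule lower_tail_pair_change) (use A' m in \<open>auto simp: s_def\<close>)
    also have "\<dots> \<le> lower_tail (gen_poly A q) m"
      using neg unfolding prod by (simp add: mult_nonneg_nonpos)
    finally have "(\<Sum>x\<in>A. (q x)\<^sup>2) \<le> (\<Sum>x\<in>A. (?r x)\<^sup>2)" using lex r by blast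
    moreover have "(\<Sum>x\<in>A. (?r x)\<^sup>2) = (\<Sum>x\<in>A - {i,j}. (q x)\<^sup>2) + (s\<^sup>2 + s\<^sup>2)"
      by (rule sum_pair_update[OF A'])
    moreover have "(\<Sum>x\<in>A. (q x)\<^sup>2) = (\<Sum>x\<in>A - {i,j}. (q x)\<^sup>2) + ((q i)\<^sup>2 + (q j)\<^sup>2)"
      using sum_pair_update[OF A', of "\<lambda>x. x\<^sup>2" q "q i" "q j"] by simp
    moreover have "(q i)\<^sup>2 + (q j)\<^sup>2 - (s\<^sup>2 + s\<^sup>2) = (q j - q i)\<^sup>2 / 2"
      by (simp add: s_def power2_eq_square field_simps)
    ultimately have "(q j - q i)\<^sup>2 \<le> 0" by linarith
    then show False using lt by simp
  qed
  then show "coeff (gen_poly (A - {i,j}) q) m > coeff (gen_poly (A - {i,j}) q) (m - 1)" by simp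
  show "q i = 0 \<or> q j = 1"
  proof (rule ccontr)
    assume "\<not> (q i = 0 \<or> q j = 1)"
    then have pos: "q i > 0" "q j < 1" using qi qj by auto
    \<comment> \<open>the largest spread that keeps both parameters in the unit interval\<close>
    define e where "e = min (q i) (1 - q j)"
    have e: "e > 0" "e \<le> q i" "e \<le> 1 - q j" using pos by (auto simp: e_def)
    let ?r = "q(i := q i - e, j := q j + e)"
    have r: "?r \<in> cube_slice A \<mu>"
      by (rule cube_slice_pair_update) (use A' q qi qj e in auto)
    have "lower_tail (gen_poly A ?r) m
        = lower_tail (gen_poly A q) m + ((q i - e) * (q j + e) - q i * q j) * ?D"
      by (rule lower_tail_pair_change) (use A' m in auto)
    moreover have "(q i - e) * (q j + e) - q i * q j = - (e * (q j - q i + e))"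
      by (simp add: algebra_simps)
    moreover have "e * (q j - q i + e) > 0" using e lt by simp
    ultimately have "lower_tail (gen_poly A ?r) m < lower_tail (gen_poly A q) m"
      using D by (simp add: mult_pos_pos)
    then show False using min[OF r] by simp
  qed
qed

lemma gen_poly_three_values:
  assumes "finite B" "\<And>j. j \<in> B \<Longrightarrow> q j \<in> {0, a, 1}" "0 < a" "a < 1"
  obtains s M where "gen_poly B q = monom 1 s * [:1 - a, a:] ^ M"
    "sum q B = real s + real M * a"
proof -
  have "\<exists>s M. gen_poly B q = monom 1 s * [:1 - a, a:] ^ M \<and> sum q B = real s + real M * a"
    using assms(1,2)
  proof (induction B rule: finite_induct)
    case empty
    show ?case by (rule exI[of _ 0], rule exI[of _ 0]) (simp add: gen_poly_def)
  next
    case (insert x B)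
    then obtain s M where IH: "gen_poly B q = monom 1 s * [:1 - a, a:] ^ M"
      "sum q B = real s + real M * a" by auto
    have step: "gen_poly (insert x B) q = [:1 - q x, q x:] * gen_poly B q"
      "sum q (insert x B) = q x + sum q B"
      using insert.hyps by (simp_all add: gen_poly_def)
    have "q x \<in> {0, a, 1}" using insert.prems by simp
    then consider "q x = 0" | "q x = a" | "q x = 1" by auto
    then show ?case
    proof cases
      case 1
      then show ?thesis using IH step by auto
    next
      case 2
      then have "gen_poly (insert x B) q = monom 1 s * [:1 - a, a:] ^ Suc M"
        unfolding step IH by (simp only: power_Suc mult.left_commute)
      moreover have "sum q (insert x B) = real s + real (Suc M) * a"
        unfolding step IH 2 by (simp add: algebra_simps)
      ultimately show ?thesis by blast
    next
      case 3
      have "monom (1::real) (Suc s) = [:0, 1:] * monom 1 s" by (simp add: monom_Suc)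
      then have "gen_poly (insert x B) q = monom 1 (Suc s) * [:1 - a, a:] ^ M"
        unfolding step IH 3 by (simp only: mult.assoc) simp
      moreover have "sum q (insert x B) = real (Suc s) + real M * a"
        unfolding step IH 3 by simp
      ultimately show ?thesis by blast
    qed
  qed
  then show ?thesis using that by blast
qed

text \<open>Hoeffding's inequality: among Bernoulli convolutions with a given mean not exceeding \<open>m\<close>, the
  binomial law has the smallest probability of at most \<open>m\<close> successes. If a lexicographic minimiser
  had two distinct parameters, all its parameters would lie in \<open>{0, b, 1}\<close> for a single \<open>b\<close>, so the
  summands other than these two would have a shifted binomial law. As the mean is at most \<open>m\<close>, this
  law is already past its mode at \<open>m\<close>, which contradicts \<open>minimiser_pair\<close>.\<close>

theorem hoeffding_binomial_minimal:
  assumes A: "finite A" "A \<noteq> {}" and p: "\<And>j. j \<in> A \<Longrightarrow> p j \<in> {0..1}"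
    and m: "m \<ge> 1" "sum p A \<le> real m"
  defines "a \<equiv> sum p A / real (card A)"
  shows "lower_tail ([:1 - a, a:] ^ card A) m \<le> lower_tail (gen_poly A p) m"
proof -
  define \<mu> where "\<mu> = sum p A"
  let ?C = "cube_slice A \<mu>"
  define p' where "p' = (\<lambda>j. if j \<in> A then p j else 0)"
  have p'C: "p' \<in> ?C" using p by (auto simp: cube_slice_def p'_def \<mu>_def)
  have p'p: "gen_poly A p' = gen_poly A p" by (rule gen_poly_cong) (simp add: p'_def)
  have c1: "continuous_on ?C (\<lambda>q. lower_tail (gen_poly A q) m)"
    by (rule continuous_on_subset[OF continuous_cum_gen_poly[OF A(1)]]) simp
  have c2: "continuous_on ?C (\<lambda>q. \<Sum>x\<in>A. (q x)\<^sup>2)"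
    by (intro continuous_on_sum continuous_on_power
        continuous_on_subset[OF continuous_on_product_coordinates]) simp
  obtain q where q: "q \<in> ?C"
    and min: "\<And>r. r \<in> ?C \<Longrightarrow> lower_tail (gen_poly A q) m \<le> lower_tail (gen_poly A r) m"
    and lex: "\<And>r. r \<in> ?C \<Longrightarrow> lower_tail (gen_poly A r) m \<le> lower_tail (gen_poly A q) m
                \<Longrightarrow> (\<Sum>x\<in>A. (q x)\<^sup>2) \<le> (\<Sum>x\<in>A. (r x)\<^sup>2)"
    using lexicographic_minimiser[OF compact_cube_slice _ c1 c2] p'C by blast
  have pair: "coeff (gen_poly (A - {i,j}) q) m > coeff (gen_poly (A - {i,j}) q) (m - 1)"
      "q i = 0 \<or> q j = 1" if "i \<in> A" "j \<in> A" "q i < q j" for i j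
    by (rule minimiser_pair[OF A(1) that(1,2) q m(1) _ _ that(3)]; fact min lex)+
  have q01: "q j \<in> {0..1}" if "j \<in> A" for j using q that unfolding cube_slice_def by force
  have sq: "sum q A = \<mu>" using q by (simp add: cube_slice_def)
  have const: "q i = q j" if ij: "i \<in> A" "j \<in> A" for i j
  proof (rule ccontr)
    assume "q i \<noteq> q j"
    then obtain i j where ij: "i \<in> A" "j \<in> A" and lt: "q i < q j"
      using ij by (metis linorder_neqE_linordered_idom)
    have "\<exists>b. 0 < b \<and> b < 1 \<and> (\<forall>x\<in>A. q x \<in> {0, b, 1})"
    proof (cases "\<exists>x\<in>A. 0 < q x \<and> q x < 1")
      case True
      then obtain x where x: "x \<in> A" "0 < q x" "q x < 1" by blast
      have "q y \<in> {0, q x, 1}" if "y \<in> A" for y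
        using pair(2)[OF x(1) that] pair(2)[OF that x(1)] x by (cases "q x" "q y" rule: linorder_cases) auto
      then show ?thesis using x by blast
    next
      case False
      \<comment> \<open>without interior parameters, any value strictly between 0 and 1 serves as \<open>b\<close>\<close>
      have "q x \<in> {0, 1/2, 1}" if "x \<in> A" for x
        using False q01[OF that] that by (auto simp: not_less less_le)
      then show ?thesis by (intro exI[of _ "1/2"]) auto
    qed
    then obtain b where b: "0 < b" "b < 1" and val: "\<And>x. x \<in> A \<Longrightarrow> q x \<in> {0, b, 1}" by blast
    obtain s M where P: "gen_poly (A - {i,j}) q = monom 1 s * [:1 - b, b:] ^ M"
      and sum: "sum q (A - {i,j}) = real s + real M * b"
      using gen_poly_three_values[of "A - {i,j}" q b] A(1) val b by auto
    have "\<mu> = sum q (A - {i,j}) + (q i + q j)"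
      using sum_pair_update[OF A(1) ij, of "\<lambda>x. x" q "q i" "q j"] lt sq by (cases "i = j") auto
    moreover have "q i + q j \<ge> b" using val[OF ij(1)] val[OF ij(2)] lt b by auto
    ultimately have k: "(real M + 1) * b \<le> real m - real s"
      using m(2) sum unfolding \<mu>_def by (simp add: algebra_simps)
    moreover have "(real M + 1) * b > 0" using b by simp
    ultimately have sm: "s < m" by simp
    have "coeff ([:1 - b, b:] ^ M) (m - s) \<le> coeff ([:1 - b, b:] ^ M) (m - s - 1)"
      by (rule binomial_coeff_past_mode) (use b k sm in \<open>auto simp: of_nat_diff\<close>)
    then have "coeff (gen_poly (A - {i,j}) q) m \<le> coeff (gen_poly (A - {i,j}) q) (m - 1)"
      using sm unfolding P by (auto simp: coeff_monom_mult diff_right_commute)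
    then show False using pair(1)[OF ij lt] by simp
  qed
  have "q j = a" if "j \<in> A" for j
  proof -
    have "\<mu> = (\<Sum>x\<in>A. q j)" unfolding sq[symmetric] by (rule sum.cong) (auto intro: const that)
    then show ?thesis using A by (simp add: a_def \<mu>_def)
  qed
  then have "gen_poly A q = [:1 - a, a:] ^ card A" by (simp add: gen_poly_def)
  then show ?thesis using min[OF p'C] p'p by simp
qed

section \<open>Binomial and Poisson-binomial distribution functions\<close>

lemma pmf_bernoulli_sum:
  assumes "finite A" "\<And>j. j \<in> A \<Longrightarrow> p j \<in> {0..1}"
  shows "pmf (map_pmf (\<lambda>\<omega>. \<Sum>j\<in>A. of_bool (\<omega> j)) (Pi_pmf A False (\<lambda>j. bernoulli_pmf (p j)))) k
     = coeff (gen_poly A p) k"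
  using assms
proof (induction A arbitrary: k rule: finite_induct)
  case empty
  then show ?case by (simp add: gen_poly_def pmf_return)
next
  case (insert x A)
  define S :: "nat pmf" where
    "S = map_pmf (\<lambda>\<omega>. \<Sum>j\<in>A. of_bool (\<omega> j)) (Pi_pmf A False (\<lambda>j. bernoulli_pmf (p j)))"
  have S: "pmf S k = coeff (gen_poly A p) k" for k
    unfolding S_def using insert by auto
  have "(\<Sum>j\<in>insert x A. of_bool ((f(x := y)) j)) = of_bool y + (\<Sum>j\<in>A. of_bool (f j) :: nat)" for y f
    by (subst sum.insert) (use insert.hyps in \<open>auto intro!: sum.cong simp del: sum_of_bool_eq\<close>)
  then have "map_pmf (\<lambda>\<omega>. \<Sum>j\<in>insert x A. of_bool (\<omega> j)) (Pi_pmf (insert x A) False (\<lambda>j. bernoulli_pmf (p j)))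
      = bernoulli_pmf (p x) \<bind> (\<lambda>y. map_pmf (\<lambda>s. of_bool y + s) S)"
    using insert.hyps
    by (simp add: Pi_pmf_insert S_def pair_pmf_def map_pmf_def bind_assoc_pmf bind_return_pmf
        del: sum.insert sum_of_bool_eq fun_upd_apply)
  moreover have "pmf (bernoulli_pmf (p x) \<bind> (\<lambda>y. map_pmf (\<lambda>s. of_bool y + s) S)) k
      = p x * pmf (map_pmf Suc S) k + (1 - p x) * pmf S k"
  proof -
    have "(+) (Suc 0) = Suc" "(+) (0::nat) = (\<lambda>s. s)" by auto
    then show ?thesis using insert.prems by (simp add: pmf_bind mult.commute)
  qed
  moreover have "pmf (map_pmf Suc S) k = (if k = 0 then 0 else pmf S (k - 1))"
    by (cases k) (auto simp: pmf_map_inj' intro: pmf_map_outside)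
  moreover have "coeff (gen_poly (insert x A) p) k
      = (1 - p x) * coeff (gen_poly A p) k + (if k = 0 then 0 else p x * coeff (gen_poly A p) (k - 1))"
    using insert.hyps by (simp add: gen_poly_def coeff_linear_mult del: mult_pCons_left)
  ultimately show ?case by (simp add: S)
qed

lemma prob_bernoulli_convolution_atMost:
  assumes "p \<in> unit_cube n"
  shows "measure_pmf.prob (bernoulli_convolution n p) {..m} = lower_tail (gen_poly {1..n} p) m"
proof -
  have "p j \<in> {0..1}" if "j \<in> {1..n}" for j using assms that by (auto simp: unit_cube_def PiE_iff)
  then have "pmf (bernoulli_convolution n p) k = coeff (gen_poly {1..n} p) k" for k
    unfolding bernoulli_convolution_def by (intro pmf_bernoulli_sum) auto
  then show ?thesis by (simp add: measure_measure_pmf_finite lower_tail_def)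
qed

definition binomial_cdf :: "nat \<Rightarrow> nat \<Rightarrow> real \<Rightarrow> real" where
  "binomial_cdf n m q = lower_tail ([:1 - q, q:] ^ n) m"

lemma prob_binomial_atMost:
  assumes "q \<in> {0..1}"
  shows "measure_pmf.prob (binomial_pmf n q) {..m} = binomial_cdf n m q"
  using assms by (simp add: measure_measure_pmf_finite lower_tail_def coeff_one_minus_power binomial_cdf_def)

lemma prob_binomial_tail:
  assumes q: "q \<in> {0..1}"
  shows "measure_pmf.prob (binomial_pmf n q) {Suc m..n} = 1 - binomial_cdf n m q"
proof -
  have "set_pmf (binomial_pmf n q) \<subseteq> {..n}"
    using q by (auto simp: set_pmf_binomial_eq split: if_splits)
  then have "measure_pmf.prob (binomial_pmf n q) {Suc m..n} = measure_pmf.prob (binomial_pmf n q) (- {..m})"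
    by (intro measure_pmf.finite_measure_eq_AE) (auto simp: AE_measure_pmf_iff)
  also have "\<dots> = 1 - measure_pmf.prob (binomial_pmf n q) {..m}"
    using measure_pmf.prob_compl[of "{..m}" "binomial_pmf n q"] by (simp add: Compl_eq_Diff_UNIV)
  finally show ?thesis using prob_binomial_atMost[OF q] by simp
qed

lemma continuous_binomial_cdf: "continuous_on S (binomial_cdf n m)"
  unfolding binomial_cdf_def lower_tail_def coeff_one_minus_power by (intro continuous_intros)

lemma binomial_cdf_0: "binomial_cdf n m 0 = 1"
  unfolding binomial_cdf_def lower_tail_def by (simp add: one_pCons[symmetric])

lemma binomial_cdf_1:
  assumes "m < n"
  shows "binomial_cdf n m 1 = 0"
  unfolding binomial_cdf_def lower_tail_def coeff_one_minus_power
  by (rule sum.neutral) (use assms in auto)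

text \<open>With \<open>U\<close> and \<open>V\<close> the Bernoulli factors for \<open>q\<close> and \<open>r\<close>, the factor
  \<open>V - U = - (r - q) (1 - x)\<close> of \<open>V\<^sup>n - U\<^sup>n\<close> turns the difference of the tails into a coefficient
  of \<open>\<Sum>i<n. V\<^sup>i U\<^sup>n\<^sup>-\<^sup>1\<^sup>-\<^sup>i\<close>, of which the summand \<open>i = m\<close> is positive even when \<open>q = 0\<close> or \<open>r = 1\<close>.\<close>

lemma binomial_cdf_strict_antimono:
  assumes q: "0 \<le> q" "q < r" "r \<le> 1" and m: "m < n"
  shows "binomial_cdf n m r < binomial_cdf n m q"
proof -
  obtain l where n: "n = Suc l" using m by (cases n) auto
  define U V where "U = [:1 - q, q:]" and "V = [:1 - r, r:]"
  have nonneg: "0 \<le> coeff (V ^ i * U ^ (l - i)) m" for i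
    unfolding coeff_mult U_def V_def coeff_one_minus_power using q by (intro sum_nonneg) auto
  have "0 < coeff (V ^ m) m * coeff (U ^ (l - m)) (m - m)"
    unfolding U_def V_def coeff_one_minus_power using q by simp
  also have "\<dots> \<le> coeff (V ^ m * U ^ (l - m)) m"
    unfolding coeff_mult
    by (rule member_le_sum) (use q in \<open>auto simp: U_def V_def coeff_one_minus_power\<close>)
  also have "\<dots> \<le> (\<Sum>i<Suc l. coeff (V ^ i * U ^ (l - i)) m)"
    using m n by (intro member_le_sum nonneg) auto
  also have "\<dots> = coeff (\<Sum>i<Suc l. V ^ i * U ^ (l - i)) m" by (simp add: coeff_sum)
  finally have pos: "0 < coeff (\<Sum>i<Suc l. V ^ i * U ^ (l - i)) m" .
  have "V ^ n - U ^ n = (V - U) * (\<Sum>i<Suc l. V ^ i * U ^ (l - i))"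
    unfolding n by (rule diff_power_eq_sum)
  also have "V - U = smult (- (r - q)) [:1, -1:]" by (simp add: U_def V_def)
  finally have "lower_tail (V ^ n) m - lower_tail (U ^ n) m = - (r - q) * coeff (\<Sum>i<Suc l. V ^ i * U ^ (l - i)) m"
    by (metis lower_tail_diff lower_tail_smult lower_tail_difference_mult mult_smult_left)
  also have "\<dots> < 0" by (rule mult_neg_pos) (use pos q in auto)
  finally show ?thesis by (simp add: binomial_cdf_def U_def V_def)
qed

lemma binomial_cdf_le_iff:
  assumes "q \<in> {0..1}" "r \<in> {0..1}" "m < n"
  shows "binomial_cdf n m r \<le> binomial_cdf n m q \<longleftrightarrow> q \<le> r"
  using binomial_cdf_strict_antimono[of q r m n] binomial_cdf_strict_antimono[of r q m n] assms
  by (cases q r rule: linorder_cases) auto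

lemma cp_bound_solution:
  assumes "0 < \<beta>" "\<beta> < 1" "m < n"
  shows "cp_bound n \<beta> (Suc m) \<in> {0..1}" "binomial_cdf n m (cp_bound n \<beta> (Suc m)) = \<beta>"
proof -
  let ?Q = "\<lambda>p. p \<in> {0..1} \<and> measure_pmf.prob (binomial_pmf n p) {Suc m..n} = 1 - \<beta>"
  have Q: "?Q p \<longleftrightarrow> p \<in> {0..1} \<and> binomial_cdf n m p = \<beta>" for p
    by (auto simp: prob_binomial_tail)
  have "\<exists>p\<ge>0. p \<le> 1 \<and> binomial_cdf n m p = \<beta>"
    by (rule IVT2') (use assms in \<open>auto simp: binomial_cdf_0 binomial_cdf_1 continuous_binomial_cdf\<close>)
  then obtain p where p: "?Q p" unfolding Q by auto
  have "\<exists>!p. ?Q p"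
  proof (rule ex1I)
    show "?Q p" by (rule p)
    fix r assume "?Q r"
    then show "r = p" using p binomial_cdf_le_iff[of p r m n] binomial_cdf_le_iff[of r p m n] assms(3)
      unfolding Q by auto
  qed
  then have "?Q (cp_bound n \<beta> (Suc m))" unfolding cp_bound_def by (rule theI')
  then show "cp_bound n \<beta> (Suc m) \<in> {0..1}" "binomial_cdf n m (cp_bound n \<beta> (Suc m)) = \<beta>"
    unfolding Q by auto
qed

section \<open>The binomial distribution function at an integer mean\<close>

lemma lower_tail_monom_mult: "lower_tail (monom 1 s * Q) (s + k) = lower_tail Q k"
proof -
  have "lower_tail (monom 1 s * Q) (s + k) = (\<Sum>i\<in>{s..s + k}. coeff Q (i - s))"
    unfolding lower_tail_def by (rule sum.mono_neutral_cong_right) (auto simp: coeff_monom_mult)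
  also have "\<dots> = lower_tail Q k"
    using sum.shift_bounds_cl_nat_ivl[of "\<lambda>i. coeff Q (i - s)" 0 s k]
    by (simp add: lower_tail_def atLeast0AtMost add.commute)
  finally show ?thesis .
qed

text \<open>Hoeffding's inequality is used here as an upper bound for the binomial law, by comparison with
  \<open>s\<close> certain successes, \<open>r\<close> certain failures and four fair coins, which has the same mean \<open>s + 2\<close>;
  \<open>11 / 16\<close> is the probability of at most two heads among the four coins.\<close>

lemma binomial_cdf_at_integer_mean_interior:
  "binomial_cdf (s + 4 + r) (s + 2) (real (s + 2) / real (s + 4 + r)) \<le> 11 / 16"
proof -
  define A where "A = {1..s + 4 + r}"
  define p where "p = (\<lambda>j. if j \<le> s then 1 else if j \<le> s + 4 then 1/2 else 0 :: real)"
  have "gen_poly A p = monom 1 s * [:1/2, 1/2:] ^ 4"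
    by (simp add: A_def gen_poly_def p_def prod.ub_add_nat monom_altdef pCons_one)
  moreover have sum: "sum p A = real (s + 2)"
    by (simp add: A_def p_def sum.ub_add_nat)
  moreover have "lower_tail ([:1/2, 1/2:] ^ 4) 2 = 11 / 16"
    using coeff_one_minus_power[of "1/2" 4] by (simp add: lower_tail_def numeral_2_eq_2 binomial_eq_0 eval_nat_numeral)
  ultimately have "lower_tail (gen_poly A p) (s + 2) = 11 / 16" by (simp only: lower_tail_monom_mult)
  moreover have "lower_tail ([:1 - sum p A / real (card A), sum p A / real (card A):] ^ card A) (s + 2) \<le> lower_tail (gen_poly A p) (s + 2)"
    by (rule hoeffding_binomial_minimal) (use sum in \<open>auto simp: A_def p_def\<close>)
  moreover have "card A = s + 4 + r" by (simp add: A_def)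
  ultimately show ?thesis unfolding binomial_cdf_def sum by (simp only:)
qed

text \<open>The left-hand side is the reciprocal of \<open>(1 + 1/(n - 1))\<^sup>n\<^sup>-\<^sup>1\<close>, which is at most \<open>e\<close>.\<close>

lemma one_minus_inverse_power_ge:
  assumes "n \<ge> 2"
  shows "(1 - 1 / real n) ^ (n - 1) \<ge> 1 / exp 1"
proof -
  obtain l where n: "n = Suc l" "l \<ge> 1" using assms by (cases n) auto
  have "1 - 1 / real n = real l / real n" "1 + 1 / real l = real n / real l"
    using n by (simp_all add: field_simps)
  then have eq: "(1 - 1 / real n) * (1 + 1 / real l) = 1" using n by simp
  have "(1 + 1 / real l) ^ l \<le> exp (1 / real l) ^ l"
    by (intro power_mono exp_ge_add_one_self) auto
  also have "\<dots> = exp 1" using n by (simp flip: exp_of_nat_mult)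
  finally have le: "(1 + 1 / real l) ^ l \<le> exp 1" .
  have "1 = (1 - 1 / real n) ^ l * (1 + 1 / real l) ^ l" by (simp only: eq power_one flip: power_mult_distrib)
  also have "\<dots> \<le> (1 - 1 / real n) ^ l * exp 1"
    by (rule mult_left_mono[OF le]) (use n in auto)
  finally show ?thesis using n by (simp add: divide_le_eq)
qed

lemma beta_crit_eq:
  assumes "n \<ge> 2"
  shows "beta_crit n = binomial_cdf n 1 (1 / real n)"
    "beta_crit n = (1 - 1 / real n) ^ (n - 1) * (2 - 1 / real n)"
proof -
  have "{0, 1} = {..1::nat}" by auto
  then show 1: "beta_crit n = binomial_cdf n 1 (1 / real n)"
    unfolding beta_crit_def using assms by (subst prob_binomial_atMost[symmetric]) auto
  have "beta_crit n = (1 - 1 / real n) ^ n + (1 - 1 / real n) ^ (n - 1)"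
    unfolding 1 binomial_cdf_def lower_tail_def coeff_one_minus_power using assms by simp
  moreover have "(1 - 1 / real n) ^ n = (1 - 1 / real n) ^ (n - 1) * (1 - 1 / real n)"
    using assms by (cases n) auto
  ultimately show "beta_crit n = (1 - 1 / real n) ^ (n - 1) * (2 - 1 / real n)"
    by (simp add: algebra_simps)
qed

text \<open>Both bounds follow from \<open>(1 - 1/n)\<^sup>n\<^sup>-\<^sup>1 \<ge> 1/e\<close> when \<open>n \<ge> 8\<close>; the estimate is too weak for smaller \<open>n\<close>,
  where the rational values are compared directly.\<close>

lemma beta_crit_bounds:
  assumes "n \<ge> 2"
  shows "11 / 16 \<le> beta_crit n" "1 - (1 - 1 / real n) ^ n \<le> beta_crit n"
proof -
  let ?c = "(1 - 1 / real n) ^ (n - 1)"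
  have npow: "(1 - 1 / real n) ^ n = ?c * (1 - 1 / real n)"
    using assms by (cases n) auto
  have "11 / 16 \<le> ?c * (2 - 1 / real n) \<and> 1 \<le> ?c * (3 - 2 / real n)"
  proof (cases "n \<ge> 8")
    case True
    have "100 / 272 \<le> 1 / (exp 1 :: real)" using e_less_272 by (simp add: field_simps)
    then have c: "?c \<ge> 100 / 272" using one_minus_inverse_power_ge[OF assms] by linarith
    have inv: "1 / real n \<le> 1 / 8" using True by (simp add: field_simps)
    have "?c * (2 - 1 / real n) \<ge> 100 / 272 * (15 / 8)" by (rule mult_mono) (use c inv in auto)
    moreover have "?c * (3 - 2 / real n) \<ge> 100 / 272 * (22 / 8)"
      by (rule mult_mono) (use c inv in auto)
    moreover have "11 / 16 \<le> 100 / 272 * (15 / 8 :: real)" "1 \<le> 100 / 272 * (22 / 8 :: real)" by simp_all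
    ultimately show ?thesis by (meson order_trans)
  next
    case False
    then have "n \<in> {2,3,4,5,6,7}" using assms by auto
    then show ?thesis by (elim insertE emptyE) (simp_all add: eval_nat_numeral)
  qed
  then show "11 / 16 \<le> beta_crit n" "1 - (1 - 1 / real n) ^ n \<le> beta_crit n"
    unfolding npow beta_crit_eq(2)[OF assms] by (simp_all add: algebra_simps)
qed

text \<open>The value at \<open>m = 1\<close> is the largest. For large \<open>n\<close> the values are not monotone in \<open>m\<close>, as they
  increase again at \<open>m = n - 1\<close>; so the two end cases are computed, and all others are at most
  \<open>11 / 16\<close>.\<close>

lemma binomial_cdf_at_integer_mean:
  assumes "1 \<le> m" "m < n"
  shows "binomial_cdf n m (real m / real n) \<le> beta_crit n"
proof -
  have n: "n \<ge> 2" using assms by simp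
  consider "m = 1" | "m = n - 1" | "2 \<le> m" "m + 2 \<le> n" using assms by linarith
  then show ?thesis
  proof cases
    case 1
    then show ?thesis using beta_crit_eq(1)[OF n] by simp
  next
    case 2
    then have q: "real m / real n = 1 - 1 / real n" using n by (simp add: field_simps of_nat_diff)
    have nm: "n = Suc m" using 2 n by simp
    have "{..m} = {..n} - {n}" using nm by auto
    then have "lower_tail ([:1 / real n, 1 - 1 / real n:] ^ n) m = lower_tail ([:1 / real n, 1 - 1 / real n:] ^ n) n - (1 - 1 / real n) ^ n"
      using coeff_one_minus_power[of "1 - 1 / real n" n n]
      by (simp add: lower_tail_def sum_diff1)
    moreover have "lower_tail ([:1 / real n, 1 - 1 / real n:] ^ n) n = 1"
    proof -
      have "lower_tail ([:1 / real n, 1 - 1 / real n:] ^ n) n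
        = (\<Sum>k\<le>n. real (n choose k) * (1 - 1 / real n) ^ k * (1 / real n) ^ (n - k))"
        using coeff_one_minus_power[of "1 - 1 / real n" n] by (simp add: lower_tail_def)
      also have "\<dots> = ((1 - 1 / real n) + 1 / real n) ^ n" by (rule binomial_ring[symmetric])
      finally show ?thesis by simp
    qed
    ultimately show ?thesis using beta_crit_bounds(2)[OF n] unfolding binomial_cdf_def q by simp
  next
    case 3
    define s r where "s = m - 2" and "r = n - m - 2"
    have "m = s + 2" "n = s + 4 + r" using 3 by (auto simp: s_def r_def)
    then show ?thesis
      using binomial_cdf_at_integer_mean_interior[of s r] beta_crit_bounds(1)[OF n] by simp
  qed
qed

section \<open>Coverage of the Clopper-Pearson upray\<close>

lemma unit_cubeD: "p \<in> unit_cube n \<Longrightarrow> j \<in> {1..n} \<Longrightarrow> p j \<in> {0..1}"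
  by (auto simp: unit_cube_def PiE_iff)

lemma avg_in_unit_interval:
  assumes "p \<in> unit_cube n"
  shows "avg n p \<in> {0..1}"
proof -
  have "0 \<le> (\<Sum>j=1..n. p j)" using unit_cubeD[OF assms] by (intro sum_nonneg) auto
  moreover have "(\<Sum>j=1..n. p j) \<le> (\<Sum>j=1..n. 1)"
    using unit_cubeD[OF assms] by (intro sum_mono) auto
  ultimately show ?thesis by (cases "n = 0") (auto simp: avg_def)
qed

lemma lower_tail_gen_poly_0: "lower_tail (gen_poly A p) 0 = (\<Prod>j\<in>A. 1 - p j)"
  by (simp add: lower_tail_def gen_poly_def coeff_0_prod_list flip: poly_0_coeff_0) (simp add: poly_prod)

lemma one_minus_sum_le_prod:
  fixes p :: "'a \<Rightarrow> real"
  assumes "finite A" "\<And>j. j \<in> A \<Longrightarrow> p j \<in> {0..1}"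
  shows "1 - sum p A \<le> (\<Prod>j\<in>A. 1 - p j)"
  using assms
proof (induction A rule: finite_induct)
  case (insert x A)
  have "(1 - p x) * (1 - sum p A) \<le> (1 - p x) * (\<Prod>j\<in>A. 1 - p j)"
    using insert by (intro mult_left_mono) auto
  moreover have "0 \<le> p x * sum p A" using insert.prems by (intro mult_nonneg_nonneg sum_nonneg) auto
  ultimately show ?case using insert.hyps by (simp add: algebra_simps)
qed simp

lemma cp_bound_1:
  assumes "0 < \<beta>" "\<beta> < 1" "n \<ge> 1"
  shows "0 < cp_bound n \<beta> 1" "cp_bound n \<beta> 1 < 1" "(1 - cp_bound n \<beta> 1) ^ n = \<beta>"
    and "cp_bound n \<beta> 1 = 1 - \<beta> powr (1 / real n)"
proof -
  define g where "g = cp_bound n \<beta> 1"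
  have g: "g \<in> {0..1}" "binomial_cdf n 0 g = \<beta>"
    using cp_bound_solution[of \<beta> 0 n] assms by (auto simp: g_def)
  then have pw: "(1 - g) ^ n = \<beta>"
    by (simp add: binomial_cdf_def lower_tail_def coeff_one_minus_power)
  moreover from pw have "g \<noteq> 0" "g \<noteq> 1"
    using assms by (auto simp: power_0_left split: if_splits)
  then have g01: "0 < g" "g < 1" using g by auto
  moreover have "\<beta> powr (1 / real n) = 1 - g"
    using assms(3) g01 by (simp flip: pw add: powr_powr flip: powr_realpow)
  ultimately show "0 < cp_bound n \<beta> 1" "cp_bound n \<beta> 1 < 1" "(1 - cp_bound n \<beta> 1) ^ n = \<beta>"
    and "cp_bound n \<beta> 1 = 1 - \<beta> powr (1 / real n)"
    by (simp_all add: g_def)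
qed

lemma gamma_level_eq:
  assumes "0 < \<beta>" "\<beta> < 1" "n \<ge> 1"
  shows "gamma_level \<beta> n = 1 - real n * cp_bound n \<beta> 1"
  using cp_bound_1(4)[OF assms] by (simp add: gamma_level_def)

text \<open>When the average equals the first bound, it is covered only by the observation 0, because the
  later bounds are larger.\<close>

lemma coverage_at_first_bound:
  assumes \<beta>: "0 < \<beta>" "\<beta> < 1" and n: "n \<ge> 1" and p: "p \<in> unit_cube n"
    and avg: "avg n p = cp_bound n \<beta> 1"
  shows "coverage n (clopper_pearson n \<beta>) p = (\<Prod>j=1..n. 1 - p j)"
proof -
  have le: "cp_bound n \<beta> 1 \<le> cp_bound n \<beta> x" if "x \<in> {1..n}" for x
  proof -
    have x: "x = Suc (x - 1)" "x - 1 < n" using that by auto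
    define m where "m = x - 1"
    note x = x[folded m_def]
    have "0 < n" using n by simp
    note g0 = cp_bound_solution[OF \<beta> this] and gm = cp_bound_solution[OF \<beta> x(2)]
    have "binomial_cdf n 0 (cp_bound n \<beta> 1) \<le> binomial_cdf n m (cp_bound n \<beta> 1)"
      unfolding binomial_cdf_def lower_tail_def
      by (rule sum_mono2) (use g0 in \<open>auto simp: coeff_one_minus_power\<close>)
    then have "binomial_cdf n m (cp_bound n \<beta> x) \<le> binomial_cdf n m (cp_bound n \<beta> 1)"
      using g0 gm x by simp
    then show ?thesis using binomial_cdf_le_iff[of "cp_bound n \<beta> 1" "cp_bound n \<beta> x" m n] g0 gm x by simp
  qed
  have "{x \<in> {0..n}. avg n p \<in> clopper_pearson n \<beta> x} = {..0}"
    using le avg_in_unit_interval[OF p] unfolding clopper_pearson_def avg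
    by (auto simp: not_less split: if_splits) (metis One_nat_def Suc_leI not_gr_zero not_less)+
  then show ?thesis
    unfolding coverage_def by (simp only: prob_bernoulli_convolution_atMost[OF p] lower_tail_gen_poly_0)
qed

lemma effective_level_le_coverage:
  "p \<in> unit_cube n \<Longrightarrow> effective_level n K \<le> coverage n K p"
  unfolding effective_level_def
  by (rule cINF_lower) (auto intro!: bdd_belowI[of _ 0] simp: coverage_def)

text \<open>At equal parameters \<open>g\<close> the probability of no success is exactly \<open>\<beta>\<close>; spreading two of them by
  \<open>\<plusminus>e\<close> keeps the average and makes it smaller.\<close>

lemma not_confidence_witness:
  assumes \<beta>: "0 < \<beta>" "\<beta> < 1" and n: "n \<ge> 2"
  shows "\<exists>p\<in>unit_cube n. coverage n (clopper_pearson n \<beta>) p < \<beta>"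
proof -
  define g where "g = cp_bound n \<beta> 1"
  have g01: "0 < g" "g < 1" and pw: "(1 - g) ^ n = \<beta>"
    using cp_bound_1[OF \<beta>, of n] n by (auto simp: g_def)
  define e where "e = min g (1 - g)"
  have e: "0 < e" "e \<le> g" "e \<le> 1 - g" using g01 by (auto simp: e_def)
  define p where "p = (\<lambda>j\<in>{1..n}. if j = 1 then g + e else if j = 2 then g - e else g)"
  have p: "p \<in> unit_cube n" using e g01 by (auto simp: p_def unit_cube_def)
  obtain k where k: "n = 2 + k" using n by (metis le_Suc_ex)
  have "sum p {1..n} = real n * g"
    unfolding k by (subst sum.ub_add_nat) (auto simp: p_def k numeral_2_eq_2 algebra_simps)
  then have avg: "avg n p = g" using n by (simp add: avg_def)
  have "(\<Prod>j=1..n. 1 - p j) = (1 - g - e) * (1 - g + e) * (1 - g) ^ k"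
    unfolding k by (subst prod.ub_add_nat) (auto simp: p_def k numeral_2_eq_2 algebra_simps)
  also have "\<dots> = \<beta> - e * e * (1 - g) ^ k"
    by (simp add: pw[symmetric] k power_add power2_eq_square algebra_simps)
  also have "\<dots> < \<beta>" using e g01 by simp
  finally have "coverage n (clopper_pearson n \<beta>) p < \<beta>"
    using coverage_at_first_bound[OF \<beta> _ p avg[unfolded g_def]] n by simp
  with p show ?thesis by blast
qed

section \<open>The effective level\<close>

lemma gamma_level_gt:
  assumes "0 < \<beta>" "\<beta> < 1" "n \<ge> 1"
  shows "1 + ln \<beta> < gamma_level \<beta> n"
proof -
  have "1 - (- ln \<beta> / real n) < exp (- (- ln \<beta> / real n))"
    unfolding exp_minus_greater using assms by simp
  then have "1 - \<beta> powr (1 / real n) < - ln \<beta> / real n"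
    using assms by (simp add: powr_def)
  then have "real n * (1 - \<beta> powr (1 / real n)) < real n * (- ln \<beta> / real n)"
    using assms by (intro mult_strict_left_mono) auto
  then show ?thesis using assms by (simp add: gamma_level_def)
qed

text \<open>With \<open>t = 1/n\<close> the claim is that \<open>t \<mapsto> (1 - \<beta>\<^sup>t) / t\<close> is strictly decreasing: \<open>1 - exp (- t L)\<close> is a
  strictly concave function of \<open>t\<close> vanishing at 0, and its chords from 0 are compared
  by means of the tangent inequality for \<open>exp\<close>.\<close>

lemma gamma_level_strict_antimono:
  assumes \<beta>: "0 < \<beta>" "\<beta> < 1" and nk: "1 \<le> n" "n < k"
  shows "gamma_level \<beta> k < gamma_level \<beta> n"
proof -
  define L where "L = - ln \<beta>"
  have L: "L > 0" using \<beta> by (simp add: L_def)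
  define s t where "s = 1 / real n" and "t = 1 / real k"
  have st: "0 < t" "t < s" using nk by (auto simp: s_def t_def field_simps)
  have pw: "\<beta> powr x = exp (- (x * L))" for x using \<beta> by (simp add: powr_def L_def)
  define E where "E = exp (- (t * L))"
  have "E * (1 + t * L) \<le> E * exp (t * L)"
    by (intro mult_left_mono exp_ge_add_one_self) (simp add: E_def)
  then have E: "E * (1 + t * L) \<le> 1" by (simp add: E_def flip: exp_add)
  have "E * (1 - (s - t) * L) < E * exp (- ((s - t) * L))"
    using exp_minus_greater[of "(s - t) * L"] st L by (intro mult_strict_left_mono) (auto simp: E_def)
  also have "\<dots> = exp (- (s * L))" by (simp add: E_def algebra_simps flip: exp_add)
  finally have "t * (1 - exp (- (s * L))) < t * (1 - E * (1 - (s - t) * L))"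
    using st by (intro mult_strict_left_mono) auto
  also have "\<dots> = t * (1 - E) + (s - t) * (E * (t * L))" by (simp add: algebra_simps)
  also have "\<dots> \<le> t * (1 - E) + (s - t) * (1 - E)"
    using st E by (intro add_left_mono mult_left_mono) (auto simp: algebra_simps)
  also have "\<dots> = s * (1 - E)" by (simp add: algebra_simps)
  finally have "t * (1 - \<beta> powr s) < s * (1 - \<beta> powr t)" by (simp add: pw E_def)
  then have "(1 - \<beta> powr s) * real n < (1 - \<beta> powr t) * real k"
    using nk by (simp add: s_def t_def field_simps)
  then show ?thesis by (simp add: gamma_level_def s_def t_def mult.commute)
qed

lemma gamma_level_less:
  assumes "0 < \<beta>" "\<beta> < 1" "n \<ge> 2"
  shows "gamma_level \<beta> n < \<beta>"
  using gamma_level_strict_antimono[of \<beta> 1 n] assms by (simp add: gamma_level_def)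

lemma gamma_level_tendsto:
  assumes "0 < \<beta>"
  shows "gamma_level \<beta> \<longlonglongrightarrow> 1 + ln \<beta>"
  unfolding gamma_level_def using assms by real_asymp

text \<open>The witness puts the whole mean \<open>n g\<close> into a single coordinate. The condition \<open>exp (-1) \<le> \<beta>\<close>
  ensures \<open>n g \<le> - ln \<beta> \<le> 1\<close>, so that this is a success probability.\<close>

lemma effective_level_le_gamma_level:
  assumes \<beta>: "0 < \<beta>" "\<beta> < 1" "exp (-1) \<le> \<beta>" and n: "n \<ge> 1"
  shows "effective_level n (clopper_pearson n \<beta>) \<le> gamma_level \<beta> n"
proof -
  let ?g = "cp_bound n \<beta> 1"
  have g: "?g \<in> {0..1}" using cp_bound_solution[of \<beta> 0 n] \<beta> n by simp
  have "- 1 \<le> ln \<beta>" using \<beta> by (simp add: ln_ge_iff)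
  then have ng: "real n * ?g \<le> 1"
    using gamma_level_gt[OF \<beta>(1,2) n] gamma_level_eq[OF \<beta>(1,2) n] by linarith
  define p where "p = (\<lambda>j\<in>{1..n}. if j = 1 then real n * ?g else 0)"
  have p: "p \<in> unit_cube n" using g ng by (auto simp: p_def unit_cube_def)
  obtain k where k: "n = 1 + k" using n by (metis le_Suc_ex)
  have "sum p {1..n} = real n * ?g"
    unfolding k by (subst sum.ub_add_nat) (auto simp: p_def k)
  then have avg: "avg n p = ?g" using n by (simp add: avg_def)
  have "(\<Prod>j=1..n. 1 - p j) = 1 - real n * ?g"
    unfolding k by (subst prod.ub_add_nat) (auto simp: p_def k)
  then have "coverage n (clopper_pearson n \<beta>) p = gamma_level \<beta> n"
    using coverage_at_first_bound[OF \<beta>(1,2) n p avg] gamma_level_eq[OF \<beta>(1,2) n] by simp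
  then show ?thesis using effective_level_le_coverage[OF p] by metis
qed

text \<open>The covering observations contain an initial segment \<open>{..m}\<close> such that the average is at most the
  bound for \<open>m + 1\<close>. For \<open>m = 0\<close> the union bound gives \<open>\<gamma>\<^sub>n\<close>. For \<open>m \<ge> 1\<close> the condition
  \<open>\<beta>\<^sub>n \<le> \<beta>\<close> forces the bound for \<open>m + 1\<close> to be at most \<open>m / n\<close>, so that Hoeffding's inequality
  applies and the coverage is even at least \<open>\<beta>\<close>.\<close>

lemma gamma_level_le_coverage:
  assumes \<beta>: "0 < \<beta>" "\<beta> < 1" and n: "n \<ge> 2" and crit: "beta_crit n \<le> \<beta>"
    and p: "p \<in> unit_cube n"
  shows "gamma_level \<beta> n \<le> coverage n (clopper_pearson n \<beta>) p"
proof -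
  let ?K = "clopper_pearson n \<beta>" and ?bc = "bernoulli_convolution n p"
  have avg: "avg n p \<in> {0..1}" by (rule avg_in_unit_interval[OF p])
  have sum: "sum p {1..n} = real n * avg n p" using n by (simp add: avg_def)
  have K: "avg n p \<in> ?K x \<longleftrightarrow> x = 0 \<or> cp_bound n \<beta> x < avg n p" for x
    using avg by (auto simp: clopper_pearson_def)
  show ?thesis
  proof (cases "\<exists>m<n. avg n p \<le> cp_bound n \<beta> (Suc m)")
    case False
    have "{x \<in> {0..n}. avg n p \<in> ?K x} = {0..n}"
    proof -
      have "avg n p \<in> ?K x" if "x \<le> n" for x
        using False that unfolding K by (cases x) (auto simp: not_le Suc_le_eq)
      then show ?thesis by auto
    qed
    moreover have "measure_pmf.prob ?bc {0..n} = 1"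
    proof -
      have "(\<Sum>j=1..n. of_bool (\<omega> j)) \<le> n" for \<omega> :: "nat \<Rightarrow> bool"
        using sum_bounded_above[of "{1..n}" "\<lambda>j. of_bool (\<omega> j)" "1::nat"] by simp
      then show ?thesis
        by (subst measure_pmf.prob_eq_1)
           (auto simp: AE_measure_pmf_iff bernoulli_convolution_def simp del: sum_of_bool_eq)
    qed
    ultimately show ?thesis
      using gamma_level_less[OF \<beta> n] \<beta> by (simp add: coverage_def)
  next
    case True
    define m where "m = (LEAST m. m < n \<and> avg n p \<le> cp_bound n \<beta> (Suc m))"
    have m: "m < n" "avg n p \<le> cp_bound n \<beta> (Suc m)"
      using LeastI_ex[OF True] unfolding m_def by auto
    have below: "cp_bound n \<beta> (Suc k) < avg n p" if "k < m" for k
      using not_less_Least[OF that[unfolded m_def]] that m(1) by auto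
    have "avg n p \<in> ?K x" if "x \<le> m" for x
      using that below unfolding K by (cases x) auto
    then have "{..m} \<subseteq> {x \<in> {0..n}. avg n p \<in> ?K x}" using m(1) by auto
    then have "measure_pmf.prob ?bc {..m} \<le> coverage n ?K p"
      unfolding coverage_def by (intro measure_pmf.finite_measure_mono) auto
    then have cov: "lower_tail (gen_poly {1..n} p) m \<le> coverage n ?K p"
      by (simp only: prob_bernoulli_convolution_atMost[OF p])
    show ?thesis
    proof (cases "m = 0")
      case True
      have "1 - sum p {1..n} \<le> lower_tail (gen_poly {1..n} p) 0"
        unfolding lower_tail_gen_poly_0 by (rule one_minus_sum_le_prod) (use unit_cubeD[OF p] in auto)
      moreover have "real n * avg n p \<le> real n * cp_bound n \<beta> 1"
        using m True by (intro mult_left_mono) auto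
      moreover have "gamma_level \<beta> n = 1 - real n * cp_bound n \<beta> 1"
        using gamma_level_eq[OF \<beta>] n by simp
      ultimately show ?thesis using cov[unfolded True] sum by linarith
    next
      case False
      let ?g = "cp_bound n \<beta> (Suc m)"
      note g = cp_bound_solution[OF \<beta> m(1)]
      have mn: "real m / real n \<in> {0..1}" using m(1) by (auto simp: field_simps)
      have "binomial_cdf n m (real m / real n) \<le> binomial_cdf n m ?g"
        using binomial_cdf_at_integer_mean[of m n] False m(1) crit g by simp
      then have "?g \<le> real m / real n"
        using binomial_cdf_le_iff[OF g(1) mn m(1)] by simp
      then have "avg n p \<le> real m / real n" using m(2) by simp
      then have "sum p {1..n} \<le> real m"
        using n unfolding sum by (simp add: field_simps)
      then have "binomial_cdf n m (avg n p) \<le> lower_tail (gen_poly {1..n} p) m"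
        using hoeffding_binomial_minimal[of "{1..n}" p m] unit_cubeD[OF p] False n
        unfolding binomial_cdf_def avg_def by simp
      moreover have "\<beta> \<le> binomial_cdf n m (avg n p)"
        using binomial_cdf_le_iff[OF avg g(1) m(1)] g(2) m(2) by simp
      ultimately show ?thesis using cov gamma_level_less[OF \<beta> n] by simp
    qed
  qed
qed

lemma effective_level_clopper_pearson:
  assumes \<beta>: "0 < \<beta>" "\<beta> < 1" and n: "n \<ge> 2" and crit: "beta_crit n \<le> \<beta>"
  shows "effective_level n (clopper_pearson n \<beta>) = gamma_level \<beta> n"
proof (rule antisym)
  have "exp (-1) \<le> (1/2 :: real)"
    using exp_ge_add_one_self[of "1::real"] by (simp add: exp_minus field_simps)
  then have "exp (-1) \<le> \<beta>" using beta_crit_bounds(1)[OF n] crit by simp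
  then show "effective_level n (clopper_pearson n \<beta>) \<le> gamma_level \<beta> n"
    using effective_level_le_gamma_level[OF \<beta>] n by simp
  have "unit_cube n \<noteq> {}" by (auto simp: unit_cube_def PiE_eq_empty_iff)
  then show "gamma_level \<beta> n \<le> effective_level n (clopper_pearson n \<beta>)"
    unfolding effective_level_def using gamma_level_le_coverage[OF assms] by (intro cINF_greatest) auto
qed

theorem mainTheorem4:
  fixes \<beta> :: real
  assumes "0 < \<beta>" and "\<beta> < 1"
  shows "(\<forall>n::nat. n \<ge> 2 \<longrightarrow>
            \<not> confidence_region_avg n \<beta> (clopper_pearson n \<beta>) \<and>
            (\<exists>p \<in> unit_cube n. coverage n (clopper_pearson n \<beta>) p < \<beta>)) \<and>
         (\<forall>n::nat. n \<ge> 2 \<and> \<beta> \<ge> beta_crit n \<longrightarrow>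
            effective_level n (clopper_pearson n \<beta>) = gamma_level \<beta> n \<and>
            gamma_level \<beta> n \<in> {1 + ln \<beta><..<\<beta>}) \<and>
         strict_antimono_on {2..} (gamma_level \<beta>) \<and>
         gamma_level \<beta> \<longlonglongrightarrow> 1 + ln \<beta> \<and>
         1 + ln \<beta> < \<beta> \<and>
         (\<beta> > 2 / exp 1 \<longrightarrow>
            liminf (\<lambda>n. ereal (effective_level n (clopper_pearson n \<beta>))) < ereal \<beta>)"
proof (intro conjI allI impI)
  fix n :: nat assume n: "n \<ge> 2"
  show w: "\<exists>p \<in> unit_cube n. coverage n (clopper_pearson n \<beta>) p < \<beta>"
    by (rule not_confidence_witness[OF assms n])
  then show "\<not> confidence_region_avg n \<beta> (clopper_pearson n \<beta>)"
    by (auto simp: confidence_region_avg_def not_le)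
next
  fix n :: nat assume n: "n \<ge> 2 \<and> \<beta> \<ge> beta_crit n"
  then show "effective_level n (clopper_pearson n \<beta>) = gamma_level \<beta> n"
    using effective_level_clopper_pearson[OF assms] by simp
  show "gamma_level \<beta> n \<in> {1 + ln \<beta><..<\<beta>}"
    using gamma_level_gt[OF assms] gamma_level_less[OF assms] n by simp
next
  show "strict_antimono_on {2..} (gamma_level \<beta>)"
    using gamma_level_strict_antimono[OF assms] by (auto intro!: monotone_onI)
  show lim: "gamma_level \<beta> \<longlonglongrightarrow> 1 + ln \<beta>"
    by (rule gamma_level_tendsto[OF assms(1)])
  show lt: "1 + ln \<beta> < \<beta>"
    using gamma_level_gt[OF assms, of 2] gamma_level_less[OF assms, of 2] by simp
  assume "\<beta> > 2 / exp 1"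
  moreover have "exp (-1) \<le> 2 / (exp 1 :: real)" by (simp add: exp_minus field_simps)
  ultimately have e: "exp (-1) \<le> \<beta>" by linarith
  have "liminf (\<lambda>n. ereal (effective_level n (clopper_pearson n \<beta>))) \<le> liminf (\<lambda>n. ereal (gamma_level \<beta> n))"
    by (intro Liminf_mono eventually_mono[OF eventually_ge_at_top[of 1]])
       (simp add: effective_level_le_gamma_level[OF assms e])
  also have "\<dots> = ereal (1 + ln \<beta>)"
    by (intro lim_imp_Liminf) (use lim in auto)
  also have "\<dots> < ereal \<beta>" using lt by simp
  finally show "liminf (\<lambda>n. ereal (effective_level n (clopper_pearson n \<beta>))) < ereal \<beta>" .
qed

end
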